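(* Let $X$ be a nonempty compactum and let $\kappa$ be a regular infinite cardinal. Then there is a point $q\in X$ such that $\mathrm{Nbhd}(q,X)$ is not cofinally equivalent to $D\times E$ for any preorders $D,E$ satisfying $\mathrm{cf}(D)<\kappa<\mathrm{Add}(E)<\infty$.
   Context: A compactum is a compact Hausdorff space. $\mathrm{Nbhd}(q,X)$ is the neighborhood filter of $q$ in $X$, i.e. the set of all $U\subseteq X$ such that $q$ is in the interior of $U$, preordered by containment $\supseteq$ (smaller neighborhoods are greater). Preorders $P$ and $Q$ are cofinally equivalent if there is a preorder $R$ such that $P$ and $Q$ are order isomorphic to cofinal subsets of $R$. Products have the coordinatewise order. $\mathrm{cf}(D)$ is the least cardinality of a cofinal subset of $D$. A preorder $P$ is $\lambda$-directed if every $A\subseteq P$ with $|A|<\lambda$ has an upper bound in $P$. The additivity $\mathrm{Add}(P)$ is the least cardinal $\lambda$ for which $P$ is not $\lambda$-directed, if it exists; if $P$ has a maximum (an element above every element of $P$), then $\mathrm{Add}(P)=\infty$, where $\infty$ is regarded as greater than every cardinal.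
   Formalization: Add(P) is read as the least size of an unbounded subset (least λ with P not λ⁺-directed); the literal wording fails for X=[0,1], κ=ω, D=1, E=ω. D and E range over preorders on underlying types fixed before q; taking the type of sets of points of X yields a q for all D, E. *)

theory Defs
  imports "HOL-Analysis.Analysis"
begin

unbundle cardinal_syntax

text \<open>
  A preorder is a relation \<open>P\<close> with \<open>Preorder P\<close>; its underlying set is \<open>Field P\<close>, and
  \<open>(p, p') \<in> P\<close> reads \<open>p \<le> p'\<close>. Cardinals are the cardinal orders of the library
  (\<open>Card_order\<close>, compared by \<open>\<le>o\<close> and \<open><o\<close>).
\<close>

definition nbhds :: "'a \<Rightarrow> 'a topology \<Rightarrow> 'a set set" where
  "nbhds q X = {U. U \<subseteq> topspace X \<and> q \<in> X interior_of U}"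

definition Nbhd :: "'a \<Rightarrow> 'a topology \<Rightarrow> 'a set rel" where
  "Nbhd q X = {(U, V). U \<in> nbhds q X \<and> V \<in> nbhds q X \<and> U \<supseteq> V}"

definition prod_order :: "'d rel \<Rightarrow> 'e rel \<Rightarrow> ('d \<times> 'e) rel" where
  "prod_order D E = {((d, e), (d', e')). (d, d') \<in> D \<and> (e, e') \<in> E}"

text \<open>
  The library's \<open>cofinal\<close> asks for strictly larger elements, so that an order with
  a maximum need not have a cofinal subset in that sense. Hence the following notion.
\<close>

definition cofinal_subset :: "'p set \<Rightarrow> 'p rel \<Rightarrow> bool" where
  "cofinal_subset C P \<longleftrightarrow> C \<subseteq> Field P \<and> (\<forall>p\<in>Field P. \<exists>c\<in>C. (p, c) \<in> P)"

text \<open>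
  By \<open>iso_iff2\<close>, \<open>iso\<close> is order isomorphism (a bijection of the fields that preserves
  and reflects the relation) for arbitrary relations. Taking \<open>R\<close> on the sum type is
  no restriction: see \<open>cofinally_equivalentI\<close> below.
\<close>

definition cofinally_equivalent :: "'p rel \<Rightarrow> 'q rel \<Rightarrow> bool" where
  "cofinally_equivalent P Q \<longleftrightarrow>
     (\<exists>(R :: ('p + 'q) rel) A B f g.
        Preorder R \<and> cofinal_subset A R \<and> cofinal_subset B R \<and>
        iso P (Restr R A) f \<and> iso Q (Restr R B) g)"

definition cf :: "'p rel \<Rightarrow> 'p rel" where
  "cf P = card_of (SOME C. cofinal_subset C P \<and> (\<forall>C'. cofinal_subset C' P \<longrightarrow> |C| \<le>o |C'| ))"

definition card_directed :: "'k rel \<Rightarrow> 'p rel \<Rightarrow> bool" where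
  "card_directed lam P \<longleftrightarrow>
     (\<forall>A \<subseteq> Field P. |A| <o lam \<longrightarrow> (\<exists>u\<in>Field P. \<forall>a\<in>A. (a, u) \<in> P))"

text \<open>
  \<open>Add P\<close> is the least cardinal \<open>\<lambda>\<close> such that \<open>P\<close> is not \<open>\<lambda>\<^sup>+\<close>-directed, that is, the
  least cardinality of a subset without an upper bound (so \<open>Add \<omega> = \<omega>\<close>). With
  \<open>\<lambda>\<close>-directed in place of \<open>\<lambda>\<^sup>+\<close>-directed one would get the successor of this cardinal
  instead. The value \<open>None\<close> is \<open>\<infinity>\<close>. Cardinals on the type of \<open>P\<close> suffice, because a
  preorder without a maximum has its own field as an unbounded subset.
\<close>

definition has_maximum :: "'p rel \<Rightarrow> bool" where
  "has_maximum P \<longleftrightarrow> (\<exists>m\<in>Field P. \<forall>p\<in>Field P. (p, m) \<in> P)"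

definition Add :: "'p rel \<Rightarrow> 'p rel option" where
  "Add P =
     (if has_maximum P then None
      else Some (SOME lam. Card_order lam \<and> \<not> card_directed (cardSuc lam) P \<and>
                   (\<forall>mu :: 'p rel. Card_order mu \<and> \<not> card_directed (cardSuc mu) P \<longrightarrow> lam \<le>o mu)))"


subsection \<open>Independence of the types chosen above\<close>

lemma Preorder_refl: "Preorder P \<Longrightarrow> x \<in> Field P \<Longrightarrow> (x, x) \<in> P"
  by (auto simp: preorder_on_def refl_on_def)

lemma Preorder_trans: "Preorder P \<Longrightarrow> (x, y) \<in> P \<Longrightarrow> (y, z) \<in> P \<Longrightarrow> (x, z) \<in> P"
  unfolding preorder_on_def by (meson transD)

lemma Field_restricted:
  "(\<And>x. x \<in> S \<Longrightarrow> (h x, h x) \<in> R) \<Longrightarrow> Field {(x, y). x \<in> S \<and> y \<in> S \<and> (h x, h y) \<in> R} = S"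
  by (auto simp: Field_def)

lemma Field_Restr_Preorder:
  assumes "Preorder R" "A \<subseteq> Field R"
  shows "Field (Restr R A) = A"
proof
  show "Field (Restr R A) \<subseteq> A" by (auto simp: Field_def)
  show "A \<subseteq> Field (Restr R A)"
  proof
    fix x assume "x \<in> A"
    then have "(x, x) \<in> Restr R A" using Preorder_refl[OF assms(1)] assms(2) by blast
    then show "x \<in> Field (Restr R A)" by (rule FieldI1)
  qed
qed

lemma cf_attained:
  assumes "Preorder P"
  shows "\<exists>C. cofinal_subset C P \<and> cf P = |C|"
    and "cofinal_subset C' P \<Longrightarrow> cf P \<le>o |C'|"
proof -
  let ?Q = "\<lambda>C. cofinal_subset C P \<and> (\<forall>C'. cofinal_subset C' P \<longrightarrow> |C| \<le>o |C'| )"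
  have "cofinal_subset (Field P) P"
    using Preorder_refl[OF assms] by (auto simp: cofinal_subset_def)
  then have "card_of ` {C. cofinal_subset C P} \<noteq> {}" by blast
  moreover have "\<forall>r \<in> card_of ` {C. cofinal_subset C P}. Card_order r"
    using card_of_Card_order by blast
  ultimately have "\<exists>C. ?Q C"
    using exists_minim_Card_order[of "card_of ` {C. cofinal_subset C P}"] by fastforce
  then have "?Q (SOME C. ?Q C)" by (rule someI_ex)
  then show "\<exists>C. cofinal_subset C P \<and> cf P = |C|"
    and "cofinal_subset C' P \<Longrightarrow> cf P \<le>o |C'|"
    unfolding cf_def by blast+
qed

lemma less_Add_less_infinity_iff:
  fixes P :: "'p rel" and kappa :: "'k rel"
  assumes P: "Preorder P" and k: "Card_order kappa"
  shows "(\<exists>lam. Add P = Some lam \<and> kappa <o lam) \<longleftrightarrow>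
         \<not> has_maximum P \<and> card_directed (cardSuc kappa) P"
proof (cases "has_maximum P")
  case True
  then show ?thesis by (simp add: Add_def)
next
  case False
  let ?S = "{mu :: 'p rel. Card_order mu \<and> \<not> card_directed (cardSuc mu) P}"
  let ?Q = "\<lambda>lam :: 'p rel. Card_order lam \<and> \<not> card_directed (cardSuc lam) P \<and>
              (\<forall>mu :: 'p rel. Card_order mu \<and> \<not> card_directed (cardSuc mu) P \<longrightarrow> lam \<le>o mu)"
  have card_in_S: "|A| \<in> ?S"
    if "A \<subseteq> Field P" "\<not> (\<exists>u\<in>Field P. \<forall>a\<in>A. (a, u) \<in> P)" for A
  proof -
    have "\<not> card_directed (cardSuc |A| ) P"
      using that cardSuc_greater[OF card_of_Card_order[of A]]
      unfolding card_directed_def by blast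
    then show ?thesis using card_of_Card_order by simp
  qed
  have "|Field P| \<in> ?S"
    using card_in_S[of "Field P"] False unfolding has_maximum_def by blast
  then have "?S \<noteq> {}" by (metis empty_iff)
  moreover have "\<forall>r\<in>?S. Card_order r" by simp
  ultimately have "\<exists>r\<in>?S. \<forall>r'\<in>?S. r \<le>o r'" by (rule exists_minim_Card_order)
  then obtain r where r: "r \<in> ?S" "\<forall>r'\<in>?S. r \<le>o r'" by (rule bexE)
  have "?Q r" using r by simp
  then have "\<exists>lam. ?Q lam" by (rule exI)
  then have "?Q (SOME lam. ?Q lam)" by (rule someI_ex)
  moreover have "Add P = Some (SOME lam. ?Q lam)"
    unfolding Add_def by (simp only: False if_False)
  ultimately obtain lam where lam: "Add P = Some lam" "?Q lam"
    by (rule that[rotated])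
  have "kappa <o lam \<longleftrightarrow> card_directed (cardSuc kappa) P"
  proof
    assume less: "kappa <o lam"
    show "card_directed (cardSuc kappa) P"
      unfolding card_directed_def
    proof (intro allI impI, rule ccontr)
      fix A assume A: "A \<subseteq> Field P" "|A| <o cardSuc kappa"
        and unb: "\<not> (\<exists>u\<in>Field P. \<forall>a\<in>A. (a, u) \<in> P)"
      have "lam \<le>o |A|" using card_in_S[OF A(1) unb] lam by blast
      moreover have "|A| \<le>o kappa"
        using A(2) cardSuc_ordLeq_ordLess[OF k card_of_Card_order] by blast
      ultimately show False
        using less not_ordLess_ordLeq[OF less] ordLeq_transitive[of lam "|A|" kappa] by simp
    qed
  next
    assume dir: "card_directed (cardSuc kappa) P"
    show "kappa <o lam"
    proof (rule ccontr)
      assume "\<not> kappa <o lam"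
      then have le: "lam \<le>o kappa"
        using lam(2) k not_ordLess_iff_ordLeq[of lam kappa]
        by (simp add: card_order_on_well_order_on)
      then have "cardSuc lam \<le>o cardSuc kappa"
        using lam(2) k cardSuc_mono_ordLeq[of lam kappa] by simp
      with dir have "card_directed (cardSuc lam) P"
        unfolding card_directed_def using ordLess_ordLeq_trans[of _ "cardSuc lam" "cardSuc kappa"]
        by blast
      then show False using lam by blast
    qed
  qed
  then show ?thesis using lam(1) False by auto
qed

text \<open>
  Any preorder \<open>R\<close>, on any type, into which \<open>P\<close> and \<open>Q\<close> map with cofinal images,
  preserving and reflecting the order, witnesses cofinal equivalence.
\<close>

lemma cofinally_equivalentI:
  fixes P :: "'p rel" and Q :: "'q rel" and R :: "'r rel"
  assumes P: "Preorder P" and Q: "Preorder Q" and R: "Preorder R"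
    and f: "cofinal_subset (f ` Field P) R"
      "\<And>x y. x \<in> Field P \<Longrightarrow> y \<in> Field P \<Longrightarrow> (x, y) \<in> P \<longleftrightarrow> (f x, f y) \<in> R"
    and g: "cofinal_subset (g ` Field Q) R"
      "\<And>x y. x \<in> Field Q \<Longrightarrow> y \<in> Field Q \<Longrightarrow> (x, y) \<in> Q \<longleftrightarrow> (g x, g y) \<in> R"
  shows "cofinally_equivalent P Q"
proof -
  define h where "h = case_sum f g"
  define S where "S = {(x, y). x \<in> Field P <+> Field Q \<and> y \<in> Field P <+> Field Q \<and> (h x, h y) \<in> R}"
  have hR: "h x \<in> Field R" if "x \<in> Field P <+> Field Q" for x
    using that f(1) g(1) by (auto simp: h_def cofinal_subset_def)
  have FS: "Field S = Field P <+> Field Q"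
    unfolding S_def using Preorder_refl[OF R hR] by (rule Field_restricted)
  have S: "Preorder S"
    unfolding preorder_on_def FS
  proof (intro conjI)
    show "S \<subseteq> (Field P <+> Field Q) \<times> (Field P <+> Field Q)" by (auto simp: S_def)
    show "refl_on (Field P <+> Field Q) S"
      using Preorder_refl[OF R hR] by (simp add: S_def refl_on_def)
    show "trans S"
      by (rule transI) (simp add: S_def, blast intro: Preorder_trans[OF R])
  qed
  have A: "cofinal_subset (Inl ` Field P) S"
    unfolding cofinal_subset_def FS
  proof (intro conjI ballI)
    fix x assume x: "x \<in> Field P <+> Field Q"
    obtain p where "p \<in> Field P" "(h x, f p) \<in> R"
      using f(1) hR[OF x] unfolding cofinal_subset_def by blast
    then show "\<exists>c\<in>Inl ` Field P. (x, c) \<in> S"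
      using x by (auto simp: S_def h_def)
  qed auto
  have B: "cofinal_subset (Inr ` Field Q) S"
    unfolding cofinal_subset_def FS
  proof (intro conjI ballI)
    fix x assume x: "x \<in> Field P <+> Field Q"
    obtain p where "p \<in> Field Q" "(h x, g p) \<in> R"
      using g(1) hR[OF x] unfolding cofinal_subset_def by blast
    then show "\<exists>c\<in>Inr ` Field Q. (x, c) \<in> S"
      using x by (auto simp: S_def h_def)
  qed auto
  have FA: "Field (Restr S A) = A" if "A \<subseteq> Field S" for A
    using S that by (rule Field_Restr_Preorder)
  have "iso P (Restr S (Inl ` Field P)) Inl"
    unfolding iso_iff2 using f(2) FA[of "Inl ` Field P"] FS
    by (auto simp: bij_betw_def S_def h_def)
  moreover have "iso Q (Restr S (Inr ` Field Q)) Inr"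
    unfolding iso_iff2 using g(2) FA[of "Inr ` Field Q"] FS
    by (auto simp: bij_betw_def S_def h_def)
  ultimately show ?thesis
    unfolding cofinally_equivalent_def using S A B by blast
qed

definition pullback :: "'p set \<Rightarrow> ('p \<Rightarrow> 'd) \<Rightarrow> 'd rel \<Rightarrow> 'p rel" where
  "pullback S phi D = {(x, y). x \<in> S \<and> y \<in> S \<and> (phi x, phi y) \<in> D}"

lemma pullback:
  assumes D: "Preorder D" and phi: "cofinal_subset (phi ` S) D"
  shows "Field (pullback S phi D) = S"
    and "Preorder (pullback S phi D)"
    and "cf (pullback S phi D) \<le>o cf D"
    and "has_maximum (pullback S phi D) \<Longrightarrow> has_maximum D"
    and "card_directed lam D \<Longrightarrow> card_directed lam (pullback S phi D)"
proof -
  have in_D: "phi x \<in> Field D" if "x \<in> S" for x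
    using that phi unfolding cofinal_subset_def by blast
  have cof: "\<exists>x\<in>S. (d, phi x) \<in> D" if "d \<in> Field D" for d
    using that phi unfolding cofinal_subset_def by blast
  show FS: "Field (pullback S phi D) = S"
    unfolding pullback_def using Preorder_refl[OF D in_D] by (rule Field_restricted)
  show pre: "Preorder (pullback S phi D)"
    unfolding preorder_on_def FS
  proof (intro conjI)
    show "pullback S phi D \<subseteq> S \<times> S" by (auto simp: pullback_def)
    show "refl_on S (pullback S phi D)"
      using Preorder_refl[OF D in_D] by (simp add: pullback_def refl_on_def)
    show "trans (pullback S phi D)"
      by (rule transI) (simp add: pullback_def, elim conjE, erule (1) Preorder_trans[OF D])
  qed
  show "cf (pullback S phi D) \<le>o cf D"
  proof -
    obtain C where C: "cofinal_subset C D" "cf D = |C|"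
      using cf_attained(1)[OF D] by blast
    have "\<forall>c\<in>C. \<exists>x. x \<in> S \<and> (c, phi x) \<in> D"
      using C(1) cof unfolding cofinal_subset_def by blast
    then obtain k where k: "\<And>c. c \<in> C \<Longrightarrow> k c \<in> S \<and> (c, phi (k c)) \<in> D"
      by metis
    have "cofinal_subset (k ` C) (pullback S phi D)"
      unfolding cofinal_subset_def FS
    proof (intro conjI ballI)
      show "k ` C \<subseteq> S" using k by (simp add: image_subset_iff)
      fix x assume x: "x \<in> S"
      obtain c where c: "c \<in> C" "(phi x, c) \<in> D"
        using C(1) in_D[OF x] unfolding cofinal_subset_def by blast
      have "(phi x, phi (k c)) \<in> D"
        using Preorder_trans[OF D c(2) conjunct2[OF k[OF c(1)]]] .
      then have "(x, k c) \<in> pullback S phi D"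
        using x k[OF c(1)] by (simp add: pullback_def)
      then show "\<exists>c\<in>k ` C. (x, c) \<in> pullback S phi D"
        using c(1) by (rule bexI[OF _ imageI])
    qed
    then have "cf (pullback S phi D) \<le>o |k ` C|"
      by (rule cf_attained(2)[OF pre])
    also have "|k ` C| \<le>o |C|" by (rule card_of_image)
    finally show ?thesis using C(2) by simp
  qed
  show "has_maximum D" if max: "has_maximum (pullback S phi D)"
  proof -
    obtain m where m: "m \<in> S" "\<And>x. x \<in> S \<Longrightarrow> (phi x, phi m) \<in> D"
      using max unfolding has_maximum_def FS by (simp add: pullback_def) blast
    have "(d, phi m) \<in> D" if d: "d \<in> Field D" for d
    proof -
      obtain x where x: "x \<in> S" "(d, phi x) \<in> D" using cof[OF d] by (rule bexE)
      show ?thesis using Preorder_trans[OF D x(2) m(2)[OF x(1)]] .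
    qed
    then show ?thesis using in_D[OF m(1)] unfolding has_maximum_def by blast
  qed
  show "card_directed lam (pullback S phi D)" if dir: "card_directed lam D"
    unfolding card_directed_def FS
  proof (intro allI impI)
    fix A assume A: "A \<subseteq> S" "|A| <o lam"
    have "|phi ` A| <o lam"
      using card_of_image A(2) by (rule ordLeq_ordLess_trans)
    moreover have "phi ` A \<subseteq> Field D" using A(1) in_D by blast
    ultimately have "\<exists>u\<in>Field D. \<forall>b\<in>phi ` A. (b, u) \<in> D"
      using dir[unfolded card_directed_def, rule_format, of "phi ` A"] by metis
    then obtain u where u: "u \<in> Field D" "\<And>a. a \<in> A \<Longrightarrow> (phi a, u) \<in> D"
      by (auto simp only: ball_simps)
    obtain v where v: "v \<in> S" "(u, phi v) \<in> D" using cof[OF u(1)] by blast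
    have "(a, v) \<in> pullback S phi D" if "a \<in> A" for a
      using subsetD[OF A(1) that] v(1) Preorder_trans[OF D u(2)[OF that] v(2)]
      by (simp add: pullback_def)
    then show "\<exists>u\<in>S. \<forall>a\<in>A. (a, u) \<in> pullback S phi D" using v(1) by blast
  qed
qed

lemma prod_order:
  assumes D: "Preorder D" and E: "Preorder E"
  shows "Field (prod_order D E) = Field D \<times> Field E"
    and "Preorder (prod_order D E)"
proof -
  show F: "Field (prod_order D E) = Field D \<times> Field E"
  proof
    show "Field (prod_order D E) \<subseteq> Field D \<times> Field E"
      by (auto simp: prod_order_def Field_def)
    show "Field D \<times> Field E \<subseteq> Field (prod_order D E)"
    proof
      fix z assume "z \<in> Field D \<times> Field E"
      then have "(z, z) \<in> prod_order D E"
        using Preorder_refl[OF D] Preorder_refl[OF E] by (auto simp: prod_order_def)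
      then show "z \<in> Field (prod_order D E)" by (rule FieldI1)
    qed
  qed
  show "Preorder (prod_order D E)"
    unfolding preorder_on_def F
  proof (intro conjI)
    show "prod_order D E \<subseteq> (Field D \<times> Field E) \<times> (Field D \<times> Field E)"
      by (auto simp: prod_order_def FieldI1 FieldI2)
    show "refl_on (Field D \<times> Field E) (prod_order D E)"
      using Preorder_refl[OF D] Preorder_refl[OF E] by (auto simp: prod_order_def refl_on_def)
    show "trans (prod_order D E)"
    proof (rule transI)
      fix x y z assume "(x, y) \<in> prod_order D E" "(y, z) \<in> prod_order D E"
      then show "(x, z) \<in> prod_order D E"
        unfolding prod_order_def by (auto intro: Preorder_trans[OF D] Preorder_trans[OF E])
    qed
  qed
qed

text \<open>
  For a given \<open>P\<close>, factors \<open>D\<close>, \<open>E\<close> of arbitrary types can be replaced by factors on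
  the type of \<open>P\<close>. So a point \<open>q\<close> of \<open>X\<close> that works for all \<open>D\<close>, \<open>E\<close> on the type of
  \<open>Nbhd q X\<close> works for all preorders \<open>D\<close>, \<open>E\<close>, whatever their types.
\<close>

lemma factors_on_same_type:
  fixes P :: "'p rel" and D :: "'d rel" and E :: "'e rel"
  assumes P: "Preorder P" "Field P \<noteq> {}"
    and D: "Preorder D" and E: "Preorder E" and k: "Card_order kappa"
    and cfD: "cf D <o kappa" and AddE: "\<exists>lam. Add E = Some lam \<and> kappa <o lam"
    and eq: "cofinally_equivalent P (prod_order D E)"
  shows "\<exists>(D' :: 'p rel) (E' :: 'p rel). Preorder D' \<and> Preorder E' \<and> cf D' <o kappa \<and>
           (\<exists>lam. Add E' = Some lam \<and> kappa <o lam) \<and>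
           cofinally_equivalent P (prod_order D' E')"
proof -
  obtain R :: "('p + 'd \<times> 'e) rel" and A B f g
    where R: "Preorder R" and A: "cofinal_subset A R" and B: "cofinal_subset B R"
      and f: "iso P (Restr R A) f" and g: "iso (prod_order D E) (Restr R B) g"
    using eq unfolding cofinally_equivalent_def by blast
  have FR: "Field (Restr R Y) = Y" if "cofinal_subset Y R" for Y
    using R that by (simp add: Field_Restr_Preorder cofinal_subset_def)
  have fA: "f ` Field P = A" and gB: "g ` (Field D \<times> Field E) = B"
    using f g FR[OF A] FR[OF B] prod_order(1)[OF D E] by (auto simp: iso_iff2 bij_betw_def)
  have f_iff: "(x, y) \<in> P \<longleftrightarrow> (f x, f y) \<in> R" if "x \<in> Field P" "y \<in> Field P" for x y
    using f that fA by (auto simp: iso_iff2)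
  have g_iff: "(d, d') \<in> D \<and> (e, e') \<in> E \<longleftrightarrow> (g (d, e), g (d', e')) \<in> R"
    if "d \<in> Field D" "d' \<in> Field D" "e \<in> Field E" "e' \<in> Field E" for d d' e e'
  proof -
    have "((d, e), (d', e')) \<in> prod_order D E \<longleftrightarrow> (g (d, e), g (d', e')) \<in> Restr R B"
      using g that prod_order(1)[OF D E] unfolding iso_iff2 by blast
    then show ?thesis using that gB by (auto simp: prod_order_def)
  qed
  have AR: "A \<subseteq> Field R" and BR: "B \<subseteq> Field R"
    using A B by (auto simp: cofinal_subset_def)
  have "\<forall>p\<in>Field P. \<exists>z. z \<in> Field D \<times> Field E \<and> (f p, g z) \<in> R"
  proof
    fix p assume "p \<in> Field P"
    then have "f p \<in> Field R" using fA AR by blast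
    then show "\<exists>z. z \<in> Field D \<times> Field E \<and> (f p, g z) \<in> R"
      using B unfolding cofinal_subset_def gB[symmetric] by blast
  qed
  then obtain h where h: "\<And>p. p \<in> Field P \<Longrightarrow> h p \<in> Field D \<times> Field E"
      "\<And>p. p \<in> Field P \<Longrightarrow> (f p, g (h p)) \<in> R"
    by metis
  obtain d0 e0 where ne: "d0 \<in> Field D" "e0 \<in> Field E"
    using P(2) h(1) by fastforce
  have cof: "\<exists>p\<in>Field P. (d, fst (h p)) \<in> D \<and> (e, snd (h p)) \<in> E"
    if de: "d \<in> Field D" "e \<in> Field E" for d e
  proof -
    have "g (d, e) \<in> Field R" using de gB BR by blast
    then obtain p where p: "p \<in> Field P" "(g (d, e), f p) \<in> R"
      using A unfolding cofinal_subset_def fA[symmetric] by blast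
    have "(g (d, e), g (fst (h p), snd (h p))) \<in> R"
      using Preorder_trans[OF R p(2) h(2)[OF p(1)]] by simp
    then show ?thesis
      using g_iff[of d "fst (h p)" e "snd (h p)"] de h(1)[OF p(1)] p(1)
      by (auto simp: mem_Times_iff)
  qed
  have cD: "cofinal_subset ((fst \<circ> h) ` Field P) D"
    unfolding cofinal_subset_def using cof[OF _ ne(2)] h(1) by (fastforce simp: mem_Times_iff)
  have cE: "cofinal_subset ((snd \<circ> h) ` Field P) E"
    unfolding cofinal_subset_def using cof[OF ne(1)] h(1) by (fastforce simp: mem_Times_iff)
  define D' where "D' = pullback (Field P) (fst \<circ> h) D"
  define E' where "E' = pullback (Field P) (snd \<circ> h) E"
  note D' = pullback[OF D cD, folded D'_def] and E' = pullback[OF E cE, folded E'_def]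
  have 1: "cf D' <o kappa"
    using D'(3) cfD by (rule ordLeq_ordLess_trans)
  have 2: "\<exists>lam. Add E' = Some lam \<and> kappa <o lam"
    using AddE E'(4,5)
    unfolding less_Add_less_infinity_iff[OF E k] less_Add_less_infinity_iff[OF E'(2) k] by blast
  define psi where "psi = (\<lambda>(x, y). g (fst (h x), snd (h y)))"
  have psi_in: "psi z \<in> B" if "z \<in> Field P \<times> Field P" for z
    using that h(1) gB by (fastforce simp: psi_def mem_Times_iff)
  have "cofinally_equivalent P (prod_order D' E')"
  proof (rule cofinally_equivalentI[OF P(1) prod_order(2)[OF D'(2) E'(2)] R])
    show "cofinal_subset (f ` Field P) R" using A fA by simp
    show "(x, y) \<in> P \<longleftrightarrow> (f x, f y) \<in> R" if "x \<in> Field P" "y \<in> Field P" for x y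
      using f_iff that .
    show "cofinal_subset (psi ` Field (prod_order D' E')) R"
      unfolding cofinal_subset_def prod_order(1)[OF D'(2) E'(2)] D'(1) E'(1)
    proof (intro conjI ballI)
      show "psi ` (Field P \<times> Field P) \<subseteq> Field R" using psi_in BR by blast
      fix r assume "r \<in> Field R"
      then obtain d e where de: "d \<in> Field D" "e \<in> Field E" "(r, g (d, e)) \<in> R"
        using B unfolding cofinal_subset_def gB[symmetric] by blast
      obtain p where p: "p \<in> Field P" "(d, fst (h p)) \<in> D" "(e, snd (h p)) \<in> E"
        using cof[OF de(1,2)] by blast
      have "(g (d, e), psi (p, p)) \<in> R"
        using g_iff[of d "fst (h p)" e "snd (h p)"] de p h(1)[OF p(1)]
        by (auto simp: psi_def mem_Times_iff)
      then show "\<exists>c\<in>psi ` (Field P \<times> Field P). (r, c) \<in> R"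
        using Preorder_trans[OF R de(3)] p(1) by blast
    qed
    fix z w assume zw: "z \<in> Field (prod_order D' E')" "w \<in> Field (prod_order D' E')"
    obtain x y x' y' where [simp]: "z = (x, y)" "w = (x', y')" by (metis surj_pair)
    have mem: "x \<in> Field P" "y \<in> Field P" "x' \<in> Field P" "y' \<in> Field P"
      using zw unfolding prod_order(1)[OF D'(2) E'(2)] D'(1) E'(1) by auto
    show "(z, w) \<in> prod_order D' E' \<longleftrightarrow> (psi z, psi w) \<in> R"
      using mem g_iff[of "fst (h x)" "fst (h x')" "snd (h y)" "snd (h y')"]
        h(1)[OF mem(1)] h(1)[OF mem(2)] h(1)[OF mem(3)] h(1)[OF mem(4)]
      by (auto simp: psi_def prod_order_def D'_def E'_def pullback_def mem_Times_iff)
  qed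
  with 1 2 D'(2) E'(2) show ?thesis by blast
qed

lemma Nbhd:
  shows "Field (Nbhd q X) = nbhds q X" and "Preorder (Nbhd q X)"
    and "q \<in> topspace X \<Longrightarrow> Field (Nbhd q X) \<noteq> {}"
proof -
  show F: "Field (Nbhd q X) = nbhds q X" by (auto simp: Nbhd_def Field_def)
  show "Preorder (Nbhd q X)"
    unfolding preorder_on_def F by (auto simp: Nbhd_def refl_on_def intro!: transI)
  show "Field (Nbhd q X) \<noteq> {}" if "q \<in> topspace X"
    unfolding F using that by (auto simp: nbhds_def intro!: exI[of _ "topspace X"])
qed

end

theory Submission
  imports Defs
begin

text \<open>
  Call a point \<open>q\<close> rectangular if \<open>Nbhd q X\<close> is cofinally equivalent to some \<open>D \<times> E\<close> with
  \<open>cf D < \<kappa> < Add E < \<infinity>\<close>. Such a \<open>q\<close> has a local base of closed sets \<open>U c e\<close>, with \<open>c\<close> in a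
  cofinal set \<open>C\<close> of fewer than \<open>\<kappa>\<close> elements of \<open>D\<close> and \<open>e\<close> in the \<open>\<kappa>\<^sup>+\<close>-directed preorder \<open>E\<close>
  (\<open>rectangular_base_exists\<close>). The two cardinal bounds act in opposite directions.

  On the one hand, a rectangular point attracts no \<open>\<kappa>\<close>-chain: the union of an increasing
  chain \<open>L\<close> of \<open>\<kappa>\<close> closed sets cannot have a rectangular \<open>q\<close> in its closure without
  containing it (\<open>closed_chain_accumulation\<close>). Indeed, for fixed \<open>e\<close> each of the fewer than
  \<open>\<kappa>\<close> sets \<open>U c e\<close> meets some \<open>L a\<close>, so by regularity of \<open>\<kappa>\<close> one \<open>L a\<close> meets them all; as
  there are only \<open>\<kappa>\<close> values of \<open>a\<close> and \<open>E\<close> is \<open>\<kappa>\<^sup>+\<close>-directed, one \<open>a\<close> serves for all \<open>e\<close>. Then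
  compactness of \<open>L a\<close> gives a point in \<open>L a\<close> and in every \<open>U c e\<close>, and that point is \<open>q\<close>.

  On the other hand, a rectangular point produces, at some point \<open>p\<close>, just such a
  \<open>\<kappa>\<close>-chain: closed sets whose union has \<open>p\<close> in its closure but not as an element
  (\<open>closed_chain_limit\<close>). Since \<open>E\<close> has no maximum, for some \<open>c\<close> the intersection of all
  \<open>U c e\<close> is not a neighborhood of \<open>q\<close>. Let \<open>core e\<close> be the intersection of all
  \<open>U b e\<close>, for \<open>b\<close> in \<open>C\<close>. No \<open>core e\<close> lies in the interiors of all \<open>U c e'\<close>, but the interior of each \<open>U c e\<close> contains some \<open>core e'\<close>. Climbing along \<open>\<kappa>\<close> steps in
  \<open>E\<close>, which \<open>\<kappa>\<^sup>+\<close>-directedness allows, makes the complements of the interiors increase and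
  the cores decrease; any point \<open>p\<close> in all cores and in the closure of the union of the
  complements will do.

  If every point of \<open>X\<close> were rectangular, the first fact, applied at the point \<open>p\<close> that the
  second one provides, would be contradicted.
\<close>

section \<open>Cardinal and order preliminaries\<close>

lemma card_directed_pair:
  assumes E: "card_directed (cardSuc kappa) E" and kappa: "Cinfinite kappa"
    and "a \<in> Field E" "b \<in> Field E"
  shows "\<exists>u\<in>Field E. (a, u) \<in> E \<and> (b, u) \<in> E"
proof -
  have "|{a, b}| <o cardSuc kappa"
    using Cfinite_ordLess_Cinfinite[OF _ Cinfinite_cardSuc[OF kappa], of "|{a, b}|"]
    card_of_Card_order[of "{a, b}"]
    by (simp add: cfinite_def Field_card_of)
  then show ?thesis
    using E assms(3,4) unfolding card_directed_def by (metis empty_subsetI insert_iff insert_subset)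
qed

lemma card_directed_bound:
  assumes E: "card_directed (cardSuc kappa) E" and kappa: "Card_order kappa"
    and "A \<subseteq> Field E" "|A| \<le>o kappa"
  shows "\<exists>u\<in>Field E. \<forall>a\<in>A. (a, u) \<in> E"
  using assms cardSuc_ordLeq_ordLess[OF kappa card_of_Card_order[of A]]
  unfolding card_directed_def by blast

text \<open>
  The form in which \<open>Add E > \<kappa>\<close> is used: if no single \<open>i\<close> worked, a common upper bound of one
  counterexample for each \<open>i\<close> would have no witness at all.
\<close>
lemma pigeonhole_directed:
  assumes E: "card_directed (cardSuc kappa) E" and kappa: "Card_order kappa" and I: "|I| \<le>o kappa"
    and ex: "\<And>e. e \<in> Field E \<Longrightarrow> \<exists>i\<in>I. P i e"
    and anti: "\<And>i e e'. i \<in> I \<Longrightarrow> (e, e') \<in> E \<Longrightarrow> P i e' \<Longrightarrow> P i e"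
  shows "\<exists>i\<in>I. \<forall>e\<in>Field E. P i e"
proof (rule ccontr)
  assume "\<not> ?thesis"
  then obtain b where b: "\<And>i. i \<in> I \<Longrightarrow> b i \<in> Field E \<and> \<not> P i (b i)" by metis
  have "|b ` I| \<le>o kappa" using card_of_image I by (rule ordLeq_transitive)
  then obtain u where "u \<in> Field E" "\<And>i. i \<in> I \<Longrightarrow> (b i, u) \<in> E"
    using card_directed_bound[OF E kappa, of "b ` I"] b by blast
  then show False using ex[of u] anti b by blast
qed

lemma regularCard_bounded:
  assumes kappa: "Cinfinite kappa" "regularCard kappa"
    and B: "B \<subseteq> Field kappa" "|B| <o kappa"
  shows "\<exists>a\<in>Field kappa. \<forall>b\<in>B. (b, a) \<in> kappa"
proof -
  have wo: "Well_order kappa" using kappa(1) by (simp add: card_order_on_well_order_on)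
  then have "refl_on (Field kappa) kappa" "trans kappa"
    by (auto simp: order_on_defs)
  then have "relChain kappa (\<lambda>a. {b. (b, a) \<in> kappa})" "B \<subseteq> (\<Union>a\<in>Field kappa. {b. (b, a) \<in> kappa})"
    using B(1) by (auto simp: relChain_def refl_on_def dest: transD)
  then show ?thesis
    using regularCard_UNION[of kappa "\<lambda>a. {b. (b, a) \<in> kappa}" B] kappa B(2) by auto
qed

text \<open>
  Recursion along \<open>\<kappa>\<close>: the at most \<open>\<kappa>\<close> values prescribed by the earlier stages have an upper
  bound, also at limit stages.
\<close>
lemma directed_chain:
  assumes E: "card_directed (cardSuc kappa) E" and kappa: "Card_order kappa"
    and g: "\<And>e. e \<in> Field E \<Longrightarrow> g e \<in> Field E"
  shows "\<exists>h. \<forall>a. h a \<in> Field E \<and> (\<forall>b. (b, a) \<in> kappa \<and> b \<noteq> a \<longrightarrow> (g (h b), h a) \<in> E)"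
proof (rule dependent_wf_choice)
  have wo: "Well_order kappa" using kappa by (simp add: card_order_on_well_order_on)
  then show "wf (kappa - Id)" by (simp add: order_on_defs)
  show "\<exists>e. e \<in> Field E \<and> (\<forall>b. (b, a) \<in> kappa \<and> b \<noteq> a \<longrightarrow> (g (f b), e) \<in> E)"
    if f: "\<And>b. (b, a) \<in> kappa - Id \<Longrightarrow> f b \<in> Field E \<and>
      (\<forall>c. (c, b) \<in> kappa \<and> c \<noteq> b \<longrightarrow> (g (f c), f b) \<in> E)" for a f
  proof -
    let ?A = "{b. (b, a) \<in> kappa \<and> b \<noteq> a}"
    have "?A \<subseteq> Field kappa" by (auto simp: Field_def)
    then have "|?A| \<le>o kappa"
      using card_of_mono1 card_of_Field_ordIso[OF kappa] ordLeq_ordIso_trans by blast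
    then have "|(\<lambda>b. g (f b)) ` ?A| \<le>o kappa"
      by (rule ordLeq_transitive[OF card_of_image])
    moreover have "(\<lambda>b. g (f b)) ` ?A \<subseteq> Field E" using f g by auto
    ultimately obtain u where u: "u \<in> Field E" "\<forall>e\<in>(\<lambda>b. g (f b)) ` ?A. (e, u) \<in> E"
      using card_directed_bound[OF E kappa] by metis
    show ?thesis
    proof (intro exI[of _ u] conjI allI impI)
      show "(g (f b), u) \<in> E" if "(b, a) \<in> kappa \<and> b \<noteq> a" for b
        using u(2) that by blast
    qed (rule u(1))
  qed
qed auto


section \<open>Compactness\<close>

lemma directed_closed_Inter_nonempty:
  assumes X: "compact_space X" and I: "I \<noteq> {}"
    and closed: "\<And>i. i \<in> I \<Longrightarrow> closedin X (A i)"
    and directed: "\<And>i j. i \<in> I \<Longrightarrow> j \<in> I \<Longrightarrow> \<exists>k\<in>I. A k \<subseteq> A i \<inter> A j"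
    and ne: "\<And>i. i \<in> I \<Longrightarrow> A i \<noteq> {}"
  shows "(\<Inter>i\<in>I. A i) \<noteq> {}"
proof
  assume empty: "(\<Inter>i\<in>I. A i) = {}"
  have "\<exists>k\<in>I. A k \<subseteq> (\<Inter>i\<in>J. A i)" if "finite J" "J \<subseteq> I" for J
    using that
  proof (induction J)
    case empty
    then show ?case using I by auto
  next
    case (insert j J)
    then obtain k where "k \<in> I" "A k \<subseteq> (\<Inter>i\<in>J. A i)" by auto
    moreover obtain l where "l \<in> I" "A l \<subseteq> A j \<inter> A k"
      using directed[of j k] insert.prems \<open>k \<in> I\<close> by auto
    ultimately show ?case by blast
  qed
  then have fin: "(\<Inter>i\<in>J. A i) \<noteq> {}" if "finite J" "J \<subseteq> I" for J
    using that ne by (metis subset_empty)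
  have "compactin X (topspace X)" using X by (simp add: compact_space_def)
  moreover have "\<forall>V \<in> (\<lambda>i. topspace X - A i) ` I. openin X V" using closed by auto
  moreover have "topspace X \<subseteq> \<Union> ((\<lambda>i. topspace X - A i) ` I)" using empty by auto
  ultimately obtain G where G: "finite G" "G \<subseteq> (\<lambda>i. topspace X - A i) ` I" "topspace X \<subseteq> \<Union> G"
    unfolding compactin_def by metis
  then obtain J where J: "J \<subseteq> I" "finite J" "G = (\<lambda>i. topspace X - A i) ` J"
    by (meson finite_subset_image)
  obtain i0 where "i0 \<in> I" using I by blast
  then have "(\<Inter>i\<in>insert i0 J. A i) \<noteq> {}" using J \<open>i0 \<in> I\<close> by (intro fin) auto
  then show False
    using J G(3) closedin_subset[OF closed[OF \<open>i0 \<in> I\<close>]] by blast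
qed

lemma compact_Hausdorff_closed_nbhd:
  assumes "compact_space X" "Hausdorff_space X" and N: "q \<in> X interior_of N"
  obtains K where "closedin X K" "q \<in> X interior_of K" "K \<subseteq> X interior_of N"
proof -
  have "neighbourhood_base_of (closedin X) X"
    using assms by (simp add: compact_Hausdorff_imp_regular_space neighbourhood_base_of_closedin)
  then obtain V K where K: "openin X V" "closedin X K" "q \<in> V" "V \<subseteq> K" "K \<subseteq> X interior_of N"
    using N openin_interior_of[of X N] unfolding neighbourhood_base_of by metis
  then have "q \<in> X interior_of K" using interior_of_maximal by blast
  then show ?thesis using that K by blast
qed


section \<open>Rectangular local bases\<close>

text \<open>
  The topological content of a cofinal equivalence between \<open>Nbhd q X\<close> and a product, with the
  first factor cut down to a small index set \<open>C\<close>. What survives of the order on the first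
  factor is \<open>U_directed\<close>; the absence of a maximum in \<open>E\<close> becomes \<open>U_thin\<close>.
\<close>
locale rectangular_base =
  fixes X :: "'a topology" and kappa :: "'k rel" and q :: 'a
    and C :: "'d set" and E :: "'e rel" and U :: "'d \<Rightarrow> 'e \<Rightarrow> 'a set"
  assumes compact: "compact_space X" and Hausdorff: "Hausdorff_space X"
    and point_in_space: "q \<in> topspace X"
    and kappa: "Cinfinite kappa" and regular: "regularCard kappa"
    and E: "Preorder E" and directed: "card_directed (cardSuc kappa) E"
    and C: "|C| <o kappa"
    and U_closed: "c \<in> C \<Longrightarrow> e \<in> Field E \<Longrightarrow> closedin X (U c e)"
    and U_nbhd: "c \<in> C \<Longrightarrow> e \<in> Field E \<Longrightarrow> q \<in> X interior_of U c e"
    and U_anti: "c \<in> C \<Longrightarrow> (e, e') \<in> E \<Longrightarrow> U c e' \<subseteq> U c e"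
    and U_directed: "c \<in> C \<Longrightarrow> c' \<in> C \<Longrightarrow> \<exists>b\<in>C. \<forall>e\<in>Field E. U b e \<subseteq> U c e \<inter> U c' e"
    and U_base: "q \<in> X interior_of N \<Longrightarrow> \<exists>c\<in>C. \<exists>e\<in>Field E. U c e \<subseteq> N"
    and U_thin: "\<exists>c\<in>C. q \<notin> X interior_of (\<Inter>e\<in>Field E. U c e)"
begin

lemma Card_order_kappa: "Card_order kappa"
  using kappa by simp

lemma Inter_U: "(\<Inter>c\<in>C. \<Inter>e\<in>Field E. U c e) \<subseteq> {q}"
proof
  fix x assume x: "x \<in> (\<Inter>c\<in>C. \<Inter>e\<in>Field E. U c e)"
  show "x \<in> {q}"
  proof (rule ccontr)
    assume "x \<notin> {q}"
    have "openin X (topspace X - {x})"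
      using Hausdorff_imp_t1_space[OF Hausdorff] by (simp add: t1_space_openin_delete_alt)
    then have "q \<in> X interior_of (topspace X - {x})"
      using point_in_space \<open>x \<notin> {q}\<close> by (simp add: interior_of_openin)
    then show False using U_base x by blast
  qed
qed

text \<open>
  Two counting steps followed by one compactness argument: \<open>|C| < \<kappa>\<close> and regularity make the
  index \<open>a\<close> independent of \<open>c\<close>, and \<open>\<kappa>\<^sup>+\<close>-directedness of \<open>E\<close> makes it independent of \<open>e\<close>.
\<close>
lemma closed_chain_accumulation:
  assumes closed: "\<And>a. a \<in> Field kappa \<Longrightarrow> closedin X (L a)"
    and chain: "\<And>a b. (a, b) \<in> kappa \<Longrightarrow> L a \<subseteq> L b"
    and q: "q \<in> X closure_of (\<Union>a\<in>Field kappa. L a)"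
  shows "q \<in> (\<Union>a\<in>Field kappa. L a)"
proof -
  define P where "P a e \<longleftrightarrow> (\<forall>c\<in>C. L a \<inter> U c e \<noteq> {})" for a e
  have "\<exists>a\<in>Field kappa. \<forall>e\<in>Field E. P a e"
  proof (rule pigeonhole_directed[OF directed Card_order_kappa])
    show "|Field kappa| \<le>o kappa"
      using card_of_Field_ordIso[OF Card_order_kappa] by (rule ordIso_imp_ordLeq)
    show "P a e" if "a \<in> Field kappa" "(e, e') \<in> E" "P a e'" for a e e'
      using that U_anti unfolding P_def by blast
    fix e assume e: "e \<in> Field E"
    have "\<exists>a\<in>Field kappa. L a \<inter> U c e \<noteq> {}" if c: "c \<in> C" for c
    proof -
      have "(\<Union>a\<in>Field kappa. L a) \<inter> (X interior_of U c e) \<noteq> {}"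
        using q U_nbhd[OF c e] openin_interior_of[of X "U c e"]
        unfolding in_closure_of by blast
      then show ?thesis using interior_of_subset[of X "U c e"] by blast
    qed
    then obtain b where b: "\<And>c. c \<in> C \<Longrightarrow> b c \<in> Field kappa \<and> L (b c) \<inter> U c e \<noteq> {}" by metis
    have "|b ` C| <o kappa" using card_of_image C by (rule ordLeq_ordLess_trans)
    then obtain a where "a \<in> Field kappa" "\<And>c. c \<in> C \<Longrightarrow> (b c, a) \<in> kappa"
      using regularCard_bounded[OF kappa regular, of "b ` C"] b by blast
    then show "\<exists>a\<in>Field kappa. P a e"
      unfolding P_def using b chain by blast
  qed
  then obtain a where a: "a \<in> Field kappa"
    and meets: "\<And>c e. c \<in> C \<Longrightarrow> e \<in> Field E \<Longrightarrow> L a \<inter> U c e \<noteq> {}"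
    unfolding P_def by blast
  have "(\<Inter>z\<in>C \<times> Field E. L a \<inter> U (fst z) (snd z)) \<noteq> {}"
  proof (rule directed_closed_Inter_nonempty[OF compact])
    show "C \<times> Field E \<noteq> {}"
      using U_thin U_base[of "topspace X"] point_in_space by auto
    fix z z' assume z: "z \<in> C \<times> Field E" "z' \<in> C \<times> Field E"
    then obtain u where u: "u \<in> Field E" "(snd z, u) \<in> E" "(snd z', u) \<in> E"
      using card_directed_pair[OF directed kappa, of "snd z" "snd z'"] by auto
    obtain b where b: "b \<in> C" "\<forall>e\<in>Field E. U b e \<subseteq> U (fst z) e \<inter> U (fst z') e"
      using U_directed[of "fst z" "fst z'"] z by auto
    have "U b u \<subseteq> U (fst z) (snd z) \<inter> U (fst z') (snd z')"
      using b u z U_anti[of "fst z" "snd z" u] U_anti[of "fst z'" "snd z'" u] by fastforce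
    then show "\<exists>k\<in>C \<times> Field E. L a \<inter> U (fst k) (snd k) \<subseteq>
        (L a \<inter> U (fst z) (snd z)) \<inter> (L a \<inter> U (fst z') (snd z'))"
      using b(1) u(1) by (intro bexI[of _ "(b, u)"]) auto
  qed (use closed[OF a] U_closed meets in auto)
  then obtain x where x: "x \<in> (\<Inter>z\<in>C \<times> Field E. L a \<inter> U (fst z) (snd z))"
    unfolding ex_in_conv[symmetric] by (rule exE)
  have in_U: "x \<in> L a \<and> x \<in> U c e" if "c \<in> C" "e \<in> Field E" for c e
    using INT_D[OF x, of "(c, e)"] that by simp
  obtain c e where "c \<in> C" "e \<in> Field E"
    using U_base[of "topspace X"] point_in_space by auto
  then have "x \<in> L a" using in_U by blast
  have "x \<in> (\<Inter>c\<in>C. \<Inter>e\<in>Field E. U c e)" using in_U by blast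
  then have "x = q" using Inter_U by (meson singletonD subsetD)
  then show ?thesis using a \<open>x \<in> L a\<close> by blast
qed

text \<open>
  The intersection of the base along the small factor. It contains \<open>q\<close> but need not be a
  neighborhood of it.
\<close>
definition core :: "'e \<Rightarrow> 'a set" where
  "core e = (\<Inter>c\<in>C. U c e)"

lemma C_nonempty: "C \<noteq> {}"
  using U_thin by blast

lemma core_anti: "(e, e') \<in> E \<Longrightarrow> core e' \<subseteq> core e"
  using U_anti unfolding core_def by blast

lemma closedin_core: "e \<in> Field E \<Longrightarrow> closedin X (core e)"
  unfolding core_def using U_closed C_nonempty by blast

lemma core_shrinks:
  assumes c: "c \<in> C" and e: "e \<in> Field E"
  shows "\<exists>e'\<in>Field E. core e' \<subseteq> X interior_of U c e"
proof -
  have "q \<in> X interior_of (X interior_of U c e)" using U_nbhd[OF c e] by simp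
  then obtain b e' where "b \<in> C" "e' \<in> Field E" "U b e' \<subseteq> X interior_of U c e"
    using U_base by blast
  then show ?thesis unfolding core_def by blast
qed

text \<open>
  Otherwise, by compactness, each \<open>U c e'\<close> would contain a single \<open>U b e\<close> with the given \<open>e\<close>.
  As there are fewer than \<open>\<kappa>\<close> candidates for \<open>b\<close>, one of them would serve for all \<open>e'\<close>, and
  the intersection of all \<open>U c e'\<close> would be a neighborhood of \<open>q\<close> after all.
\<close>
lemma core_escapes:
  assumes c: "c \<in> C" and thin: "q \<notin> X interior_of (\<Inter>e\<in>Field E. U c e)" and e: "e \<in> Field E"
  shows "\<exists>e'\<in>Field E. \<not> core e \<subseteq> X interior_of U c e'"
proof (rule ccontr)
  assume contra: "\<not> ?thesis"
  have "\<exists>b\<in>C. \<forall>e'\<in>Field E. U b e \<subseteq> U c e'"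
  proof (rule pigeonhole_directed[OF directed Card_order_kappa])
    show "|C| \<le>o kappa" using C by (rule ordLess_imp_ordLeq)
    show "U b e \<subseteq> U c e'" if "(e', e'') \<in> E" "U b e \<subseteq> U c e''" for b e' e''
      using that U_anti[OF c] by blast
    fix e' assume e': "e' \<in> Field E"
    show "\<exists>b\<in>C. U b e \<subseteq> U c e'"
    proof (rule ccontr)
      assume no: "\<not> ?thesis"
      have "(\<Inter>b\<in>C. U b e - X interior_of U c e') \<noteq> {}"
      proof (rule directed_closed_Inter_nonempty[OF compact C_nonempty])
        show "closedin X (U b e - X interior_of U c e')" if "b \<in> C" for b
          using U_closed[OF that e] by (simp add: closedin_diff)
        show "\<exists>k\<in>C. U k e - X interior_of U c e' \<subseteq>
            (U b e - X interior_of U c e') \<inter> (U b' e - X interior_of U c e')"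
          if "b \<in> C" "b' \<in> C" for b b'
          using U_directed[OF that] e by blast
        show "U b e - X interior_of U c e' \<noteq> {}" if "b \<in> C" for b
          using no that interior_of_subset[of X "U c e'"] by blast
      qed
      then obtain x where x: "x \<in> (\<Inter>b\<in>C. U b e - X interior_of U c e')" by blast
      then have "x \<in> core e" "x \<notin> X interior_of U c e'"
        using c unfolding core_def by blast+
      then show False using contra e' by blast
    qed
  qed
  then obtain b where b: "b \<in> C" "U b e \<subseteq> (\<Inter>e'\<in>Field E. U c e')" by blast
  then show False using thin U_nbhd[OF b(1) e] interior_of_mono[OF b(2)] by blast
qed

text \<open>
  The two core lemmas make the cores along a \<open>\<kappa>\<close>-chain in \<open>E\<close> play the part of the tails of a
  free sequence: the core at one stage is disjoint from \<open>L a\<close> for all earlier stages \<open>a\<close>, but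
  meets \<open>L b\<close> for all later \<open>b\<close>. So the compact sets \<open>core (h a) \<inter> closure (\<Union>a. L a)\<close> have a common
  point, which is outside every \<open>L a\<close>.
\<close>
lemma closed_chain_limit:
  obtains L p where "\<And>a. a \<in> Field kappa \<Longrightarrow> closedin X (L a)"
    and "\<And>a b. (a, b) \<in> kappa \<Longrightarrow> L a \<subseteq> L b"
    and "p \<in> X closure_of (\<Union>a\<in>Field kappa. L a)"
    and "p \<notin> (\<Union>a\<in>Field kappa. L a)"
proof -
  obtain c where c: "c \<in> C" and thin: "q \<notin> X interior_of (\<Inter>e\<in>Field E. U c e)"
    using U_thin by blast
  have "\<exists>e'. e' \<in> Field E \<and> (e, e') \<in> E \<and> core e' \<subseteq> X interior_of U c e \<and>
      \<not> core e \<subseteq> X interior_of U c e'" if e: "e \<in> Field E" for e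
  proof -
    obtain e1 where e1: "e1 \<in> Field E" "core e1 \<subseteq> X interior_of U c e"
      using core_shrinks[OF c e] by blast
    obtain e2 where e2: "e2 \<in> Field E" "\<not> core e \<subseteq> X interior_of U c e2"
      using core_escapes[OF c thin e] by blast
    obtain u where u: "u \<in> Field E" "(e1, u) \<in> E" "(e2, u) \<in> E"
      using card_directed_pair[OF directed kappa e1(1) e2(1)] by blast
    obtain v where v: "v \<in> Field E" "(e, v) \<in> E" "(u, v) \<in> E"
      using card_directed_pair[OF directed kappa e u(1)] by blast
    have "(e1, v) \<in> E" "(e2, v) \<in> E" using Preorder_trans[OF E] u v by blast+
    then have "core v \<subseteq> core e1" "X interior_of U c v \<subseteq> X interior_of U c e2"
      by (simp_all add: core_anti U_anti[OF c] interior_of_mono)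
    then show ?thesis using e1(2) e2(2) v by blast
  qed
  then obtain g where g: "\<And>e. e \<in> Field E \<Longrightarrow> g e \<in> Field E \<and> (e, g e) \<in> E \<and>
      core (g e) \<subseteq> X interior_of U c e \<and> \<not> core e \<subseteq> X interior_of U c (g e)" by metis
  then obtain h where h: "\<And>a. h a \<in> Field E"
    and step: "\<And>a b. (b, a) \<in> kappa \<Longrightarrow> b \<noteq> a \<Longrightarrow> (g (h b), h a) \<in> E"
    using directed_chain[OF directed Card_order_kappa, of g] by metis
  have mono: "(h a, h b) \<in> E" if "(a, b) \<in> kappa" for a b
    using Preorder_trans[OF E, of "h a" "g (h a)" "h b"] g[OF h] step[OF that] Preorder_refl[OF E h]
    by (cases "a = b") auto
  have succ: "\<exists>b\<in>Field kappa. a \<noteq> b \<and> (a, b) \<in> kappa" if "a \<in> Field kappa" for a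
    using infinite_Card_order_limit[OF Card_order_kappa _ that] kappa by (simp add: cinfinite_def)
  have total: "(a, b) \<in> kappa \<or> (b, a) \<in> kappa" if "a \<in> Field kappa" "b \<in> Field kappa" for a b
  proof -
    have "Well_order kappa" using Card_order_kappa by (simp add: card_order_on_well_order_on)
    then have "Total kappa" "Refl kappa" by (auto simp: order_on_defs)
    then show ?thesis using that by (cases "a = b") (auto simp: total_on_def refl_on_def)
  qed
  define L where "L a = topspace X - X interior_of U c (h a)" for a
  have chain: "L a \<subseteq> L b" if "(a, b) \<in> kappa" for a b
    using interior_of_mono[OF U_anti[OF c mono[OF that]]] unfolding L_def by blast
  have meets: "core (h a) \<inter> (\<Union>a\<in>Field kappa. L a) \<noteq> {}" if a: "a \<in> Field kappa" for a
  proof -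
    obtain b where b: "b \<in> Field kappa" "a \<noteq> b" "(a, b) \<in> kappa" using succ[OF a] by blast
    obtain x where x: "x \<in> core (h a)" "x \<notin> X interior_of U c (g (h a))" using g[OF h] by blast
    have "x \<notin> X interior_of U c (h b)"
      using x(2) interior_of_mono[OF U_anti[OF c step[OF b(3,2)]]] by blast
    moreover have "x \<in> topspace X" using x(1) closedin_subset[OF closedin_core[OF h]] by blast
    ultimately show ?thesis using x(1) b(1) unfolding L_def by blast
  qed
  have L_sub: "(\<Union>a\<in>Field kappa. L a) \<subseteq> topspace X" unfolding L_def by blast
  let ?K = "X closure_of (\<Union>a\<in>Field kappa. L a)"
  have "(\<Inter>a\<in>Field kappa. core (h a) \<inter> ?K) \<noteq> {}"
  proof (rule directed_closed_Inter_nonempty[OF compact])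
    show "Field kappa \<noteq> {}" using kappa by (auto simp: cinfinite_def)
    show "closedin X (core (h a) \<inter> ?K)" for a
      using closedin_core[OF h] by auto
    show "\<exists>k\<in>Field kappa. core (h k) \<inter> ?K \<subseteq> (core (h a) \<inter> ?K) \<inter> (core (h b) \<inter> ?K)"
      if ab: "a \<in> Field kappa" "b \<in> Field kappa" for a b
      using total[OF ab] core_anti[OF mono] ab by blast
    show "core (h a) \<inter> ?K \<noteq> {}" if "a \<in> Field kappa" for a
      using meets[OF that] closure_of_subset[OF L_sub] by blast
  qed
  then obtain p where p: "\<And>a. a \<in> Field kappa \<Longrightarrow> p \<in> core (h a) \<inter> ?K" by blast
  have "p \<notin> L a" if a: "a \<in> Field kappa" for a
  proof -
    obtain b where b: "b \<in> Field kappa" "a \<noteq> b" "(a, b) \<in> kappa" using succ[OF a] by blast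
    have "p \<in> core (g (h a))" using p[OF b(1)] core_anti[OF step[OF b(3,2)]] by blast
    then show ?thesis using g[OF h, of a] unfolding L_def by blast
  qed
  moreover have "p \<in> ?K"
  proof -
    have "Field kappa \<noteq> {}" using kappa by (auto simp: cinfinite_def)
    then obtain a where "a \<in> Field kappa" by blast
    then show ?thesis using p by blast
  qed
  moreover have "closedin X (L a)" for a unfolding L_def by (simp add: closedin_diff)
  ultimately show ?thesis using that[of L p] chain by blast
qed

end

text \<open>
  The base set at \<open>(d, e)\<close> has to be antitone in \<open>(d, e)\<close>, so a choice of some neighborhood
  above \<open>(d, e)\<close> in the common preorder \<open>R\<close> is not enough; the union \<open>V d e\<close> of all of them is
  antitone, and still small enough to form a base because \<open>R\<close> reflects inclusion of
  neighborhoods. Its closure is taken for the sake of compactness arguments.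

  Some \<open>\<Inter>e. U c e\<close> is not a neighborhood: if all were, they would form a local base indexed by
  \<open>C\<close>, fewer than \<open>\<kappa>\<close> elements of \<open>D \<times> E\<close> would be cofinal, and an upper bound of their second
  coordinates would be a maximum of \<open>E\<close>.
\<close>
lemma rectangular_base_exists:
  fixes X :: "'a topology" and kappa :: "'k rel" and D :: "'d rel" and E :: "'e rel"
  assumes X: "compact_space X" "Hausdorff_space X" and q: "q \<in> topspace X"
    and kappa: "Cinfinite kappa" "regularCard kappa"
    and D: "Preorder D" and E: "Preorder E" and cfD: "cf D <o kappa"
    and AddE: "\<exists>lam. Add E = Some lam \<and> kappa <o lam"
    and eq: "cofinally_equivalent (Nbhd q X) (prod_order D E)"
  shows "\<exists>C U. rectangular_base X kappa q (C :: 'd set) E U"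
proof -
  have card: "Card_order kappa" using kappa by simp
  have no_max: "\<not> has_maximum E" and dir: "card_directed (cardSuc kappa) E"
    using AddE less_Add_less_infinity_iff[OF E card] by blast+
  obtain R :: "('a set + 'd \<times> 'e) rel" and A B f g
    where R: "Preorder R" and A: "cofinal_subset A R" and B: "cofinal_subset B R"
      and f: "iso (Nbhd q X) (Restr R A) f" and g: "iso (prod_order D E) (Restr R B) g"
    using eq unfolding cofinally_equivalent_def by blast
  have FR: "Field (Restr R Y) = Y" if "cofinal_subset Y R" for Y
    using R that by (simp add: Field_Restr_Preorder cofinal_subset_def)
  have fA: "f ` nbhds q X = A" and gB: "g ` (Field D \<times> Field E) = B"
    using f g FR[OF A] FR[OF B] prod_order(1)[OF D E] Nbhd(1)[of q X]
    by (auto simp: iso_iff2 bij_betw_def)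
  have f_iff: "(f M, f N) \<in> R \<longleftrightarrow> N \<subseteq> M" if MN: "M \<in> nbhds q X" "N \<in> nbhds q X" for M N
  proof -
    have "(M, N) \<in> Nbhd q X \<longleftrightarrow> (f M, f N) \<in> Restr R A"
      using f MN Nbhd(1)[of q X] unfolding iso_iff2 by blast
    then show ?thesis using MN fA by (auto simp: Nbhd_def)
  qed
  have g_iff: "(g (d, e), g (d', e')) \<in> R \<longleftrightarrow> (d, d') \<in> D \<and> (e, e') \<in> E"
    if "d \<in> Field D" "d' \<in> Field D" "e \<in> Field E" "e' \<in> Field E" for d d' e e'
  proof -
    have "((d, e), (d', e')) \<in> prod_order D E \<longleftrightarrow> (g (d, e), g (d', e')) \<in> Restr R B"
      using g that prod_order(1)[OF D E] unfolding iso_iff2 by blast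
    then show ?thesis using that gB by (auto simp: prod_order_def)
  qed
  have f_below: "\<exists>d\<in>Field D. \<exists>e\<in>Field E. (f N, g (d, e)) \<in> R" if "N \<in> nbhds q X" for N
  proof -
    have "f N \<in> Field R" using that fA A unfolding cofinal_subset_def by blast
    then show ?thesis using B unfolding cofinal_subset_def gB[symmetric] by blast
  qed
  have g_below: "\<exists>N\<in>nbhds q X. (g (d, e), f N) \<in> R" if "d \<in> Field D" "e \<in> Field E" for d e
  proof -
    have "g (d, e) \<in> Field R" using that gB B unfolding cofinal_subset_def by blast
    then show ?thesis using A unfolding cofinal_subset_def fA[symmetric] by blast
  qed
  obtain C where C: "cofinal_subset C D" "cf D = |C|" using cf_attained(1)[OF D] by blast
  have CD: "C \<subseteq> Field D" using C(1) unfolding cofinal_subset_def by blast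
  define V where "V d e = \<Union> {N \<in> nbhds q X. (g (d, e), f N) \<in> R}" for d e
  define U where "U d e = X closure_of V d e" for d e
  have V_sub: "V d e \<subseteq> U d e" for d e
    unfolding U_def by (rule closure_of_subset) (auto simp: V_def nbhds_def)
  have U_nbhd: "q \<in> X interior_of U d e" if de: "d \<in> Field D" "e \<in> Field E" for d e
  proof -
    obtain N where N: "N \<in> nbhds q X" "(g (d, e), f N) \<in> R" using g_below[OF de] by blast
    then have "N \<subseteq> U d e" using V_sub[of d e] unfolding V_def by blast
    then have "X interior_of N \<subseteq> X interior_of U d e" by (rule interior_of_mono)
    then show ?thesis using N(1) unfolding nbhds_def by blast
  qed
  have U_anti: "U d' e' \<subseteq> U d e" if "(d, d') \<in> D" "(e, e') \<in> E" for d d' e e'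
  proof -
    have "(g (d, e), g (d', e')) \<in> R" using that g_iff by (simp add: FieldI1 FieldI2)
    then have "V d' e' \<subseteq> V d e" unfolding V_def using Preorder_trans[OF R] by blast
    then show ?thesis unfolding U_def by (rule closure_of_mono)
  qed
  have U_base: "\<exists>c\<in>C. \<exists>e\<in>Field E. U c e \<subseteq> N" if N: "q \<in> X interior_of N" for N
  proof -
    obtain K where K: "closedin X K" "q \<in> X interior_of K" "K \<subseteq> X interior_of N"
      using compact_Hausdorff_closed_nbhd[OF X N] .
    then have Kn: "K \<in> nbhds q X" using closedin_subset unfolding nbhds_def by blast
    obtain d e where de: "d \<in> Field D" "e \<in> Field E" "(f K, g (d, e)) \<in> R"
      using f_below[OF Kn] by blast
    obtain c where c: "c \<in> C" "(d, c) \<in> D" using C(1) de(1) unfolding cofinal_subset_def by blast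
    have "V d e \<subseteq> K"
      unfolding V_def using f_iff[OF Kn] Preorder_trans[OF R de(3)] by blast
    then have "U d e \<subseteq> K" unfolding U_def using K(1) by (rule closure_of_minimal)
    moreover have "U c e \<subseteq> U d e" using U_anti[OF c(2)] Preorder_refl[OF E de(2)] by blast
    ultimately show ?thesis using c(1) de(2) K(3) interior_of_subset[of X N] by blast
  qed
  have qX: "q \<in> X interior_of topspace X" using q by simp
  have U_directed: "\<exists>b\<in>C. \<forall>e\<in>Field E. U b e \<subseteq> U c e \<inter> U c' e" if cc': "c \<in> C" "c' \<in> C" for c c'
  proof -
    obtain e where e: "e \<in> Field E" using U_base[OF qX] by blast
    obtain M N where M: "M \<in> nbhds q X" "(g (c, e), f M) \<in> R"
      and N: "N \<in> nbhds q X" "(g (c', e), f N) \<in> R"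
      using g_below[of c e] g_below[of c' e] cc' CD e by blast
    have MN: "M \<inter> N \<in> nbhds q X" using M(1) N(1) unfolding nbhds_def by (auto simp: interior_of_Int)
    obtain d e' where de: "d \<in> Field D" "e' \<in> Field E" "(f (M \<inter> N), g (d, e')) \<in> R"
      using f_below[OF MN] by blast
    have "(f M, f (M \<inter> N)) \<in> R" "(f N, f (M \<inter> N)) \<in> R" using f_iff M N MN by auto
    then have "(g (c, e), g (d, e')) \<in> R" "(g (c', e), g (d, e')) \<in> R"
      using Preorder_trans[OF R] M(2) N(2) de(3) by blast+
    then have "(c, d) \<in> D" "(c', d) \<in> D" using g_iff cc' CD e de by blast+
    moreover obtain b where b: "b \<in> C" "(d, b) \<in> D"
      using C(1) de(1) unfolding cofinal_subset_def by blast
    ultimately have "(c, b) \<in> D" "(c', b) \<in> D" using Preorder_trans[OF D] by blast+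
    then show ?thesis using b(1) U_anti Preorder_refl[OF E] by blast
  qed
  have U_thin: "\<exists>c\<in>C. q \<notin> X interior_of (\<Inter>e\<in>Field E. U c e)"
  proof (rule ccontr)
    assume contra: "\<not> ?thesis"
    define W where "W c = topspace X \<inter> (\<Inter>e\<in>Field E. U c e)" for c
    have W: "W c \<in> nbhds q X" if "c \<in> C" for c
      using contra that q unfolding nbhds_def W_def by (auto simp: interior_of_Int)
    then have "\<forall>c\<in>C. \<exists>d e. d \<in> Field D \<and> e \<in> Field E \<and> (f (W c), g (d, e)) \<in> R"
      using f_below by blast
    then obtain dd ee where de: "\<And>c. c \<in> C \<Longrightarrow>
        dd c \<in> Field D \<and> ee c \<in> Field E \<and> (f (W c), g (dd c, ee c)) \<in> R" by metis
    have "|ee ` C| \<le>o kappa"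
      using ordLeq_ordLess_trans[OF card_of_image] cfD C(2) ordLess_imp_ordLeq by metis
    then obtain m where m: "m \<in> Field E" "\<And>c. c \<in> C \<Longrightarrow> (ee c, m) \<in> E"
      using card_directed_bound[OF dir card, of "ee ` C"] de by blast
    have "(e, m) \<in> E" if e: "e \<in> Field E" for e
    proof -
      obtain d where d: "d \<in> Field D" using U_base[OF qX] CD by blast
      obtain N where N: "N \<in> nbhds q X" "(g (d, e), f N) \<in> R" using g_below[OF d e] by blast
      then obtain c e' where c: "c \<in> C" "e' \<in> Field E" "U c e' \<subseteq> N"
        using U_base[of N] unfolding nbhds_def by blast
      then have "W c \<subseteq> N" unfolding W_def by blast
      then have "(f N, f (W c)) \<in> R" using f_iff N(1) W[OF c(1)] by blast
      then have "(g (d, e), g (dd c, ee c)) \<in> R"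
        using Preorder_trans[OF R] N(2) de[OF c(1)] by blast
      then have "(e, ee c) \<in> E" using g_iff[of d "dd c" e "ee c"] d e de[OF c(1)] by blast
      then show ?thesis using Preorder_trans[OF E] m(2)[OF c(1)] by blast
    qed
    then show False using no_max m(1) unfolding has_maximum_def by blast
  qed
  have "rectangular_base X kappa q C E U"
  proof
    show "|C| <o kappa" using cfD C(2) by simp
    show "closedin X (U c e)" for c e unfolding U_def by simp
    show "U c e' \<subseteq> U c e" if "c \<in> C" "(e, e') \<in> E" for c e e'
      using U_anti Preorder_refl[OF D] that CD by blast
  qed (use X q kappa E dir U_nbhd U_directed U_base U_thin CD in blast)+
  then show ?thesis by blast
qed

theorem theorem3p4:
  fixes X :: "'a topology" and kappa :: "'k rel"
  assumes "compact_space X" and "Hausdorff_space X" and "topspace X \<noteq> {}"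
    and "Cinfinite kappa" and "regularCard kappa"
  shows "\<exists>q\<in>topspace X.
           \<not> (\<exists>(D :: 'd rel) (E :: 'e rel).
                 Preorder D \<and> Preorder E \<and>
                 cf D <o kappa \<and>
                 (\<exists>lam. Add E = Some lam \<and> kappa <o lam) \<and>
                 cofinally_equivalent (Nbhd q X) (prod_order D E))"
proof (rule ccontr)
  assume contra: "\<not> ?thesis"
  have base: "\<exists>(C :: 'd set) (E :: 'e rel) U. rectangular_base X kappa q C E U"
    if q: "q \<in> topspace X" for q
  proof -
    obtain D :: "'d rel" and E :: "'e rel" where "Preorder D" "Preorder E" "cf D <o kappa"
      "\<exists>lam. Add E = Some lam \<and> kappa <o lam" "cofinally_equivalent (Nbhd q X) (prod_order D E)"
      using contra q by blast
    then show ?thesis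
      using rectangular_base_exists[OF assms(1,2) q assms(4,5)] by blast
  qed
  obtain q where "q \<in> topspace X" using assms(3) by blast
  then obtain C :: "'d set" and E :: "'e rel" and U where "rectangular_base X kappa q C E U"
    using base by blast
  then obtain L p where L: "\<And>a. a \<in> Field kappa \<Longrightarrow> closedin X (L a)"
      "\<And>a b. (a, b) \<in> kappa \<Longrightarrow> L a \<subseteq> L b"
    and p: "p \<in> X closure_of (\<Union>a\<in>Field kappa. L a)" "p \<notin> (\<Union>a\<in>Field kappa. L a)"
    using rectangular_base.closed_chain_limit by metis
  have "p \<in> topspace X" using p(1) closure_of_subset_topspace[of X] by blast
  then obtain C' :: "'d set" and E' :: "'e rel" and U' where "rectangular_base X kappa p C' E' U'"
    using base by blast
  then show False
    using rectangular_base.closed_chain_accumulation L p by metis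
qed

end
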